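(* Let $F=\mathbb{F}_q$ be a finite field, let $m\ge 1$, and let $R=F[x]/\langle x^m-1\rangle$. Let $C\subseteq R^2$ be a quasi-cyclic code of length $2m$ and index $2$, generated by $g_1=(g_{11}(x),g_{12}(x))$ and $g_2=(0,g_{22}(x))$, where $g_{11},g_{12},g_{22}\in F[x]$ satisfy: $g_{11}(x)\mid (x^m-1)$ and $g_{22}(x)\mid (x^m-1)$; $\deg g_{12}(x)<\deg g_{22}(x)$; and $g_{11}(x)g_{22}(x)\mid (x^m-1)g_{12}(x)$. Then $C$ is symplectic dual-containing, i.e. $C\supseteq C^{\perp_s}$, if and only if the following conditions hold (divisibility in $F[x]$): 1) $g_{11}(x)g_{22}(x)^\circ$ divides $x^m(x^m-1)$; 2) $g_{11}(x)g_{11}(x)^\circ g_{22}(x)g_{22}(x)^\circ$ divides $x^m(x^m-1)\big(g_{11}(x)g_{12}(x)^\circ-g_{11}(x)^\circ g_{12}(x)\big)$.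
   Context: A quasi-cyclic code of length $2m$ and index $2$ over $F$ (a linear subspace of $F^{2m}$ invariant under the square of the cyclic shift) is identified with an $R$-submodule of $R^2$: a vector $(c_{0,0},c_{0,1},c_{1,0},c_{1,1},\dots,c_{m-1,0},c_{m-1,1})$ corresponds to $(c_0(x),c_1(x))$ with $c_j(x)=\sum_{i=0}^{m-1} c_{i,j}x^i$. "Generated by" means generated as an $R$-module; polynomials are also regarded as elements of $R$ by reduction modulo $x^m-1$. Convention $\deg 0=-\infty$, so $g_{12}=0$ is allowed. For $f(x)\in F[x]$ with $\deg f\le m$, the transpose polynomial is $f(x)^\circ=x^m f(x^{-1})\in F[x]$. For $a=\sum_{i=0}^{m-1}a_ix^i$, $b=\sum_{i=0}^{m-1}b_ix^i$ in $R$, $\langle a,b\rangle_e=\sum_{i=0}^{m-1}a_ib_i$. The symplectic form on $R^2$ is $\langle (a,b),(a',b')\rangle_s=\langle a,b'\rangle_e-\langle b,a'\rangle_e$, and $C^{\perp_s}=\{u\in R^2: \langle u,v\rangle_s=0 \text{ for all } v\in C\}$. *)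

theory Defs
  imports "HOL-Algebra.QuotRing" "Jordan_Normal_Form.VS_Connect"
begin

definition cyclic_shift :: "'a vec \<Rightarrow> 'a vec" where
  "cyclic_shift c = vec (dim_vec c) (\<lambda>i. c $ ((i + dim_vec c - 1) mod dim_vec c))"

definition quasi_cyclic_code :: "nat \<Rightarrow> nat \<Rightarrow> 'a::field vec set \<Rightarrow> bool" where
  "quasi_cyclic_code n l D \<longleftrightarrow>
     VectorSpace.subspace class_ring D (module_vec TYPE('a) n) \<and>
     (\<forall>c\<in>D. (cyclic_shift ^^ l) c \<in> D)"

text \<open>The ring \<open>R = F[x]/(x^m - 1)\<close> is the library's factor ring, so its elements are cosets,
  that is, sets of polynomials.\<close>

definition cyc_ideal :: "nat \<Rightarrow> 'a::field poly set" where
  "cyc_ideal m = cgenideal class_ring (monom 1 m - 1)"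

definition cyc_ring :: "nat \<Rightarrow> 'a::field poly set ring" where
  "cyc_ring m = class_ring Quot (cyc_ideal m)"

definition red :: "nat \<Rightarrow> 'a::field poly \<Rightarrow> 'a poly set" where
  "red m p = cyc_ideal m +>\<^bsub>class_ring\<^esub> p"

text \<open>The \<open>R\<close>-module \<open>R\<^sup>2\<close>; as in \<^const>\<open>module_vec\<close>, the record fields \<open>mult\<close> and \<open>one\<close>
  play no role.\<close>

definition cyc_square :: "nat \<Rightarrow> ('a::field poly set, 'a poly set \<times> 'a poly set) module" where
  "cyc_square m = \<lparr>
     carrier = carrier (cyc_ring m) \<times> carrier (cyc_ring m),
     mult = undefined,
     one = undefined,
     zero = (\<zero>\<^bsub>cyc_ring m\<^esub>, \<zero>\<^bsub>cyc_ring m\<^esub>),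
     add = (\<lambda>u v. (fst u \<oplus>\<^bsub>cyc_ring m\<^esub> fst v, snd u \<oplus>\<^bsub>cyc_ring m\<^esub> snd v)),
     smult = (\<lambda>a u. (a \<otimes>\<^bsub>cyc_ring m\<^esub> fst u, a \<otimes>\<^bsub>cyc_ring m\<^esub> snd u))\<rparr>"

definition generated :: "nat \<Rightarrow> ('a::field poly set \<times> 'a poly set) set \<Rightarrow>
    ('a poly set \<times> 'a poly set) set" where
  "generated m S = LinearCombinations.module.span (cyc_ring m) (cyc_square m) S"

text \<open>The entries of \<open>c\<close> are listed as
  \<open>c\<^sub>0\<^sub>,\<^sub>0, c\<^sub>0\<^sub>,\<^sub>1, c\<^sub>1\<^sub>,\<^sub>0, c\<^sub>1\<^sub>,\<^sub>1, \<dots>\<close>, so \<open>c\<^sub>i\<^sub>,\<^sub>j\<close> has position \<open>2 * i + j\<close>.\<close>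

definition vec_to_pair :: "nat \<Rightarrow> 'a::field vec \<Rightarrow> 'a poly set \<times> 'a poly set" where
  "vec_to_pair m c =
     (red m (\<Sum>i<m. monom (c $ (2 * i)) i), red m (\<Sum>i<m. monom (c $ (2 * i + 1)) i))"

text \<open>For \<open>m \<ge> 1\<close> every element of \<open>R\<close> has exactly one representative of degree below \<open>m\<close>;
  see \<open>cyc_rep_red\<close> below.\<close>

definition cyc_rep :: "nat \<Rightarrow> 'a::field poly set \<Rightarrow> 'a poly" where
  "cyc_rep m a = (THE p. p \<in> a \<and> degree p < m)"

definition euclidean_form :: "nat \<Rightarrow> 'a::field poly set \<Rightarrow> 'a poly set \<Rightarrow> 'a" where
  "euclidean_form m a b = (\<Sum>i<m. coeff (cyc_rep m a) i * coeff (cyc_rep m b) i)"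

definition symplectic_form :: "nat \<Rightarrow> 'a::field poly set \<times> 'a poly set \<Rightarrow>
    'a poly set \<times> 'a poly set \<Rightarrow> 'a" where
  "symplectic_form m u v =
     euclidean_form m (fst u) (snd v) - euclidean_form m (snd u) (fst v)"

definition symplectic_dual :: "nat \<Rightarrow> ('a::field poly set \<times> 'a poly set) set \<Rightarrow>
    ('a poly set \<times> 'a poly set) set" where
  "symplectic_dual m C = {u \<in> carrier (cyc_square m). \<forall>v\<in>C. symplectic_form m u v = 0}"

text \<open>The polynomial \<open>x^m f(1/x)\<close>, meaningful only for \<open>degree f \<le> m\<close>.\<close>

definition transpose_poly :: "nat \<Rightarrow> 'a::field poly \<Rightarrow> 'a poly" where
  "transpose_poly m f = (\<Sum>i\<le>m. monom (coeff f i) (m - i))"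

lemma cyc_ideal_ideal: "ideal (cyc_ideal m) (class_ring :: 'a::field poly ring)"
  unfolding cyc_ideal_def by (rule cring.cgenideal_ideal[OF class_cring.is_cring]) simp

lemma cyc_ring_cring: "cring (cyc_ring m :: 'a::field poly set ring)"
  unfolding cyc_ring_def
  by (rule ideal.quotient_is_cring[OF cyc_ideal_ideal class_cring.is_cring])

lemma mem_cyc_ideal_iff: "q \<in> cyc_ideal m \<longleftrightarrow> (monom 1 m - 1) dvd q" for q :: "'a::field poly"
  unfolding cyc_ideal_def cgenideal_def by (auto simp: dvd_def mult.commute)

lemma mem_red_iff: "q \<in> red m p \<longleftrightarrow> (monom 1 m - 1) dvd (q - p)" for p q :: "'a::field poly"
proof -
  have "q \<in> red m p \<longleftrightarrow> (\<exists>h\<in>cyc_ideal m. q = h + p)"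
    unfolding red_def a_r_coset_def r_coset_def by auto
  also have "\<dots> \<longleftrightarrow> q - p \<in> cyc_ideal m"
    by (metis add_diff_cancel diff_add_cancel)
  finally show ?thesis by (simp add: mem_cyc_ideal_iff)
qed

lemma degree_xm1: "m \<ge> 1 \<Longrightarrow> degree (monom 1 m - 1 :: 'a::field poly) = m"
  using degree_add_eq_left[of "- 1" "monom 1 m :: 'a poly"] by (simp add: degree_monom_eq)

lemma cyc_rep_red:
  assumes "m \<ge> 1"
  shows "cyc_rep m (red m p) = p mod (monom 1 m - 1)"
proof -
  let ?x = "monom 1 m - 1 :: 'a poly"
  have nz: "?x \<noteq> 0" using degree_xm1[OF assms, where 'a='a] assms by force
  have deg: "degree (p mod ?x) < m"
    using degree_mod_less'[of ?x p] degree_xm1[OF assms, where 'a='a] nz assms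
    by (cases "p mod ?x = 0") auto
  show ?thesis unfolding cyc_rep_def
  proof (rule the_equality)
    show "p mod ?x \<in> red m p \<and> degree (p mod ?x) < m"
      using deg by (simp add: mem_red_iff mod_eq_dvd_iff[symmetric])
  next
    fix q assume q: "q \<in> red m p \<and> degree q < m"
    then have "q mod ?x = p mod ?x" by (simp add: mem_red_iff mod_eq_dvd_iff)
    moreover have "q mod ?x = q" using q degree_xm1[OF assms, where 'a='a] by (simp add: mod_poly_less)
    ultimately show "q = p mod ?x" by simp
  qed
qed

lemma cyc_square_module: "Module.module (cyc_ring m) (cyc_square m)"
proof -
  interpret R: cring "cyc_ring m :: 'a::field poly set ring" by (rule cyc_ring_cring)
  have "abelian_group (cyc_square m :: ('a poly set, _) Module.module)"
  proof (rule abelian_groupI)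
    fix u :: "'a poly set \<times> 'a poly set"
    assume "u \<in> carrier (cyc_square m)"
    then show "\<exists>v\<in>carrier (cyc_square m). v \<oplus>\<^bsub>cyc_square m\<^esub> u = \<zero>\<^bsub>cyc_square m\<^esub>"
      by (intro bexI[of _ "(\<ominus>\<^bsub>cyc_ring m\<^esub> fst u, \<ominus>\<^bsub>cyc_ring m\<^esub> snd u)"])
        (auto simp: cyc_square_def R.l_neg)
  qed (auto simp: cyc_square_def R.a_ac)
  then show "Module.module (cyc_ring m) (cyc_square m :: ('a poly set, _) Module.module)"
    by (intro Module.module.intro Module.module_axioms.intro R.is_cring)
      (auto simp: cyc_square_def R.l_distr R.r_distr R.m_assoc)
qed

end

theory Submission
  imports Defs
begin

text \<open>
  Write \<open>X = x\<^sup>m - 1\<close> and let \<open>\<tau>(w)\<close> be the constant coefficient of \<open>w mod X\<close>. The Euclidean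
  form is \<open>\<langle>u, p\<rangle> = \<tau>(u p(1/x))\<close>, and \<open>\<tau>\<close> vanishes on no nonzero ideal of \<open>R\<close>. Hence
  \<open>(u, v)\<close> is in the symplectic dual iff \<open>X\<close> divides \<open>u g\<^sub>2\<^sub>2(1/x)\<close> and
  \<open>u g\<^sub>1\<^sub>2(1/x) - v g\<^sub>1\<^sub>1(1/x)\<close>. With \<open>f\<^sup>*\<close> the reciprocal polynomial,
  \<open>X = g\<^sub>1\<^sub>1\<^sup>* p = g\<^sub>2\<^sub>2\<^sup>* q\<close> and \<open>g\<^sub>1\<^sub>1\<^sup>* k = q g\<^sub>1\<^sub>2\<^sup>*\<close> (such \<open>k\<close> exists because
  \<open>g\<^sub>1\<^sub>1 g\<^sub>2\<^sub>2\<close> divides \<open>X g\<^sub>1\<^sub>2\<close>), the dual is generated, up to powers of the unit \<open>x\<close>, by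
  \<open>(0, p)\<close> and \<open>(q, k)\<close>. The first of these lies in the code iff condition 1 holds, and then
  the second does iff condition 2 holds.
\<close>

section \<open>Reciprocal polynomials\<close>

text \<open>A polynomial with nonzero constant term is coprime to \<open>x\<close>: if
  \<open>x v' = c w\<close>, comparing constant terms gives \<open>w(0) = 0\<close>, so
  \<open>x\<close> divides \<open>w\<close> and cancels. Powers of \<open>x\<close> are discarded
  this way below.\<close>

lemma monom_mult_dvd_cancel:
  fixes c v :: "'a::idom poly"
  assumes "coeff c 0 \<noteq> 0"
  shows "c dvd monom 1 k * v \<longleftrightarrow> c dvd v"
proof (induction k)
  case 0
  then show ?case by simp
next
  case (Suc k)
  have "c dvd v'" if "c dvd monom 1 1 * v'" for v'
  proof -
    from that obtain w where w: "monom 1 1 * v' = c * w" by (elim dvdE)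
    have "coeff c 0 * coeff w 0 = coeff (monom 1 1 * v') 0"
      unfolding w by (simp add: coeff_mult)
    also have "\<dots> = 0" by (simp add: coeff_monom_mult)
    finally have "coeff w 0 = 0" using assms by simp
    then obtain w' where "w = monom 1 1 * w'"
      by (cases w) (auto simp: monom_Suc monom_0)
    with w have "monom 1 1 * v' = monom 1 1 * (c * w')" by (simp add: ac_simps)
    then have "v' = c * w'" by (simp add: monom_eq_0_iff)
    then show ?thesis by simp
  qed
  moreover have "monom 1 (Suc k) * v = monom 1 1 * (monom 1 k * v)"
    by (simp add: mult_monom flip: mult.assoc)
  ultimately show ?case using Suc by (metis dvd_mult)
qed

lemma coeff_0_nonzero_of_dvd:
  fixes p q :: "'a::idom poly"
  assumes "p dvd q" "coeff q 0 \<noteq> 0"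
  shows "coeff p 0 \<noteq> 0"
  using assms by (auto simp: dvd_def coeff_mult)

lemma coeff_0_xm1: "m \<ge> 1 \<Longrightarrow> coeff (monom 1 m - 1 :: 'a::field poly) 0 = - 1"
  by simp

lemma reflect_poly_xm1:
  assumes "m \<ge> 1"
  shows "reflect_poly (monom 1 m - 1 :: 'a::field poly) = - (monom 1 m - 1)"
proof (rule poly_eqI)
  fix n
  show "coeff (reflect_poly (monom 1 m - 1 :: 'a poly)) n = coeff (- (monom 1 m - 1)) n"
    using assms by (auto simp: coeff_reflect_poly degree_xm1 coeff_1)
qed

lemma reflect_poly_dvd_reflect_poly:
  fixes p q :: "'a::idom poly"
  shows "p dvd q \<Longrightarrow> reflect_poly p dvd reflect_poly q"
  by (auto simp: dvd_def reflect_poly_mult)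

lemma reflect_poly_dvd_xm1:
  fixes p :: "'a::field poly"
  assumes "m \<ge> 1" "p dvd monom 1 m - 1"
  shows "reflect_poly p dvd monom 1 m - 1"
  using reflect_poly_dvd_reflect_poly[OF assms(2)] reflect_poly_xm1[OF assms(1), where 'a='a]
  by (metis dvd_minus_iff)

text \<open>Reflection is multiplicative, fixes \<open>X\<close> up to sign and is an involution on
  polynomials with nonzero constant term. This later links condition 1 to
  \<open>g22 dvd p\<close>.\<close>

lemma reflect_poly_mult_dvd_xm1_commute:
  fixes p q :: "'a::field poly"
  assumes "m \<ge> 1" "p dvd monom 1 m - 1" "q dvd monom 1 m - 1"
  shows "p * reflect_poly q dvd monom 1 m - 1 \<longleftrightarrow> q * reflect_poly p dvd monom 1 m - 1"
proof -
  have nz: "coeff p 0 \<noteq> 0" "coeff q 0 \<noteq> 0"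
    using assms coeff_0_nonzero_of_dvd coeff_0_xm1[OF assms(1), where 'a='a]
    by (metis neg_equal_0_iff_equal zero_neq_one)+
  have "q * reflect_poly p dvd monom 1 m - 1"
    if "p * reflect_poly q dvd monom 1 m - 1" "coeff q 0 \<noteq> 0" for p q :: "'a poly"
    using reflect_poly_dvd_xm1[OF assms(1) that(1)] that(2)
    by (simp add: reflect_poly_mult mult.commute)
  then show ?thesis using nz by blast
qed

lemma coeff_transpose_poly: "coeff (transpose_poly m f) k = (if k \<le> m then coeff f (m - k) else 0)"
proof -
  have "coeff (transpose_poly m f) k = (\<Sum>i\<le>m. if i = m - k \<and> k \<le> m then coeff f i else 0)"
    unfolding transpose_poly_def coeff_sum by (rule sum.cong) auto
  also have "\<dots> = (if k \<le> m then coeff f (m - k) else 0)"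
    by (cases "k \<le> m") auto
  finally show ?thesis .
qed

text \<open>\<open>transpose_poly\<close> reverses coefficients about \<open>m\<close>,
  \<open>reflect_poly\<close> about the actual degree. The latter is multiplicative, so divisibility
  is handled with it.\<close>

lemma transpose_poly_eq_reflect_poly:
  assumes "degree f \<le> m"
  shows "transpose_poly m f = monom 1 (m - degree f) * reflect_poly f"
proof (rule poly_eqI)
  fix k
  show "coeff (transpose_poly m f) k = coeff (monom 1 (m - degree f) * reflect_poly f) k"
    using assms by (auto simp: coeff_transpose_poly coeff_monom_mult coeff_reflect_poly
        intro!: coeff_eq_0 arg_cong[where f="coeff f"])
qed

section \<open>The Euclidean form as a trace\<close>

text \<open>Represents \<open>p(1/x)\<close> modulo \<open>x\<^sup>m - 1\<close>, where \<open>x\<^sup>m\<^sup>-\<^sup>1\<close> is the inverse of \<open>x\<close>.\<close>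

definition conj_poly :: "nat \<Rightarrow> 'a::field poly \<Rightarrow> 'a poly" where
  "conj_poly m p = pcompose p (monom 1 (m - 1))"

lemma conj_poly_simps:
  "conj_poly m 0 = 0"
  "conj_poly m (p + q) = conj_poly m p + conj_poly m q"
  "conj_poly m (p * q) = conj_poly m p * conj_poly m q"
  "conj_poly m (\<Sum>i\<in>I. f i) = (\<Sum>i\<in>I. conj_poly m (f i))"
  by (simp_all add: conj_poly_def pcompose_add pcompose_mult pcompose_sum)

lemma conj_poly_monom: "conj_poly m (monom c k) = monom c ((m - 1) * k)"
  unfolding conj_poly_def
  by (induction k) (simp_all add: monom_0 pcompose_const monom_Suc[of c] pcompose_pCons mult_monom)

lemma monom_mod_xm1:
  assumes "m \<ge> 1"
  shows "monom c i mod (monom 1 m - 1) = (monom c (i mod m) :: 'a::field poly)"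
proof -
  have "(monom 1 m - 1 :: 'a poly) dvd monom 1 m ^ (i div m) - 1"
    by (metis dvd_triv_left power_diff_1_eq)
  then have "(monom 1 m - 1 :: 'a poly) dvd monom c (i mod m) * (monom 1 m ^ (i div m) - 1)"
    by (rule dvd_mult)
  also have "monom c (i mod m) * (monom 1 m ^ (i div m) - 1) = monom c i - monom c (i mod m)"
    by (simp add: monom_power mult_monom algebra_simps)
  finally have "monom c i mod (monom 1 m - 1 :: 'a poly) = monom c (i mod m) mod (monom 1 m - 1)"
    by (simp add: mod_eq_dvd_iff)
  also have "\<dots> = monom c (i mod m)"
  proof (rule mod_poly_less)
    have "degree (monom c (i mod m)) \<le> i mod m" by (rule degree_monom_le)
    also have "\<dots> < m" using assms by simp
    finally show "degree (monom c (i mod m)) < degree (monom 1 m - 1 :: 'a poly)"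
      using assms by (simp add: degree_xm1)
  qed
  finally show ?thesis .
qed

lemma mod_poly_sum: "(\<Sum>i\<in>I. f i) mod p = (\<Sum>i\<in>I. f i mod p)" for p :: "'a::field poly"
  by (induction I rule: infinite_finite_induct) (auto simp: poly_mod_add_left)

lemma transpose_poly_cong_conj_poly:
  fixes f :: "'a::field poly"
  assumes "m \<ge> 1" "degree f \<le> m"
  shows "monom 1 m - 1 dvd transpose_poly m f - conj_poly m f"
proof -
  have "f = (\<Sum>i\<le>m. monom (coeff f i) i)"
    using assms(2) by (simp add: poly_as_sum_of_monoms')
  then have "conj_poly m f = (\<Sum>i\<le>m. monom (coeff f i) ((m - 1) * i))"
    by (metis (no_types, lifting) conj_poly_simps(4) conj_poly_monom sum.cong)
  \<comment> \<open>Both exponents represent \<open>-i\<close> modulo \<open>m\<close>.\<close>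
  moreover have "(m - i) mod m = (m - 1) * i mod m" if "i \<le> m" for i
  proof -
    have "(m - 1) * i + m = m - i + m * i"
      using that assms(1) by (cases m) auto
    then show ?thesis by (metis mod_add_self2 mod_mult_self2)
  qed
  ultimately have "transpose_poly m f mod (monom 1 m - 1) = conj_poly m f mod (monom 1 m - 1)"
    unfolding transpose_poly_def by (auto simp: mod_poly_sum monom_mod_xm1[OF assms(1)] intro!: sum.cong)
  then show ?thesis by (simp add: mod_eq_dvd_iff)
qed

text \<open>Both sides are bilinear in \<open>u\<close> and \<open>p\<close>, so monomials suffice:
  on \<open>x^i\<close> and \<open>x^j\<close> each side is 1 if \<open>i\<close> and
  \<open>j\<close> agree modulo \<open>m\<close>, and 0 otherwise.\<close>

lemma euclidean_form_red_eq_coeff: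
  fixes u p :: "'a::field poly"
  assumes "m \<ge> 1"
  shows "euclidean_form m (red m u) (red m p) = coeff ((u * conj_poly m p) mod (monom 1 m - 1)) 0"
proof -
  let ?X = "monom 1 m - 1 :: 'a poly"
  let ?E = "\<lambda>u p. \<Sum>k<m. coeff (u mod ?X) k * coeff (p mod ?X) k"
  let ?T = "\<lambda>u p. coeff ((u * conj_poly m p) mod ?X) 0"
  have mono: "?E (monom c i) (monom d j) = ?T (monom c i) (monom d j)" for c d i j
  proof -
    have "?E (monom c i) (monom d j) = (\<Sum>k<m. if k = i mod m then (if i mod m = j mod m then c * d else 0) else 0)"
      by (rule sum.cong) (auto simp: monom_mod_xm1[OF assms])
    also have "\<dots> = (if i mod m = j mod m then c * d else 0)"
      using assms by (subst sum.delta) auto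
    \<comment> \<open>The exponent \<open>i + (m - 1) * j\<close> is congruent to
      \<open>i - j\<close>; passing to the integers avoids truncated subtraction.\<close>
    also have "i mod m = j mod m \<longleftrightarrow> (i + (m - 1) * j) mod m = 0"
    proof -
      have "int (i + (m - 1) * j) = int i - int j + int m * int j"
        using assms by (cases m) (simp_all add: algebra_simps)
      then have "int m dvd int (i + (m - 1) * j) \<longleftrightarrow> int m dvd int i - int j"
        by (metis dvd_add_times_triv_right_iff mult.commute)
      then have "(i + (m - 1) * j) mod m = 0 \<longleftrightarrow> int i mod int m = int j mod int m"
        by (simp only: int_dvd_int_iff mod_eq_dvd_iff flip: dvd_eq_mod_eq_0)
      then show ?thesis by (simp flip: of_nat_mod)
    qed
    finally show ?thesis
      by (auto simp: conj_poly_monom mult_monom monom_mod_xm1[OF assms])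
  qed
  have expand: "q = (\<Sum>i\<le>degree q. monom (coeff q i) i)" for q :: "'a poly"
    by (simp add: poly_as_sum_of_monoms)
  have E: "?E (\<Sum>i\<in>I. f i) (\<Sum>j\<in>J. g j) = (\<Sum>i\<in>I. \<Sum>j\<in>J. ?E (f i) (g j))"
    for f g :: "nat \<Rightarrow> 'a poly" and I J
    by (simp add: mod_poly_sum coeff_sum sum_product sum.swap[of _ "{..<m}"])
  have T: "?T (\<Sum>i\<in>I. f i) (\<Sum>j\<in>J. g j) = (\<Sum>i\<in>I. \<Sum>j\<in>J. ?T (f i) (g j))"
    for f g :: "nat \<Rightarrow> 'a poly" and I J
    by (simp add: mod_poly_sum coeff_sum sum_product conj_poly_simps)
  have "?E u p = ?T u p"
    by (subst (1 2) expand[of u], subst (1 2) expand[of p], unfold E T) (simp add: mono)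
  then show ?thesis by (simp add: euclidean_form_def cyc_rep_red[OF assms])
qed

lemma euclidean_form_monom:
  assumes "m \<ge> 1" "k < m"
  shows "euclidean_form m (red m w) (red m (monom 1 k)) = coeff (w mod (monom 1 m - 1)) k"
  using assms unfolding euclidean_form_def
  by (simp add: cyc_rep_red monom_mod_xm1 if_distrib[of "\<lambda>x. _ * x"] cong: if_cong)

text \<open>Nondegeneracy of \<tau>: taking \<open>a = x^k\<close> with \<open>k < m\<close> reads
  off the coefficient of \<open>x^k\<close> in \<open>w mod X\<close>.\<close>

lemma dvd_iff_trace_zero:
  fixes w :: "'a::field poly"
  assumes "m \<ge> 1"
  shows "monom 1 m - 1 dvd w \<longleftrightarrow> (\<forall>a. coeff ((w * conj_poly m a) mod (monom 1 m - 1)) 0 = 0)"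
proof
  assume "monom 1 m - 1 dvd w"
  then show "\<forall>a. coeff ((w * conj_poly m a) mod (monom 1 m - 1)) 0 = 0"
    by (metis coeff_0 dvd_imp_mod_0 dvd_mult2)
next
  let ?X = "monom 1 m - 1 :: 'a poly"
  assume *: "\<forall>a. coeff ((w * conj_poly m a) mod ?X) 0 = 0"
  have "coeff (w mod ?X) k = 0" for k
  proof (cases "k < m")
    case True
    then show ?thesis
      using * by (metis assms euclidean_form_monom euclidean_form_red_eq_coeff)
  next
    case False
    have "?X \<noteq> 0" using coeff_0_xm1[OF assms, where 'a='a] by force
    then have "w mod ?X = 0 \<or> degree (w mod ?X) < degree ?X" by (rule degree_mod_less)
    with False show ?thesis by (elim disjE) (simp_all add: degree_xm1[OF assms] coeff_eq_0)
  qed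
  then have "w mod ?X = 0" by (simp add: poly_eq_iff)
  then show "?X dvd w" by (simp add: mod_eq_0_iff_dvd)
qed

section \<open>Two-generator submodules and their duals\<close>

lemma red_eq_iff: "red m p = red m q \<longleftrightarrow> monom 1 m - 1 dvd p - q" for p q :: "'a::field poly"
proof
  assume "red m p = red m q"
  then show "monom 1 m - 1 dvd p - q" by (metis mem_red_iff diff_self dvd_0_right)
next
  assume *: "monom 1 m - 1 dvd p - q"
  have "monom 1 m - 1 dvd r - p \<longleftrightarrow> monom 1 m - 1 dvd r - q" for r
    using dvd_add_left_iff[OF *, of "r - p"] by simp
  then show "red m p = red m q" by (auto simp: mem_red_iff)
qed

lemma carrier_cyc_ring: "carrier (cyc_ring m) = range (red m)"
  unfolding cyc_ring_def FactRing_def red_def A_RCOSETS_def' by auto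

lemma red_ring_hom: "red m \<in> Ring.ring_hom class_ring (cyc_ring m)"
  unfolding cyc_ring_def using ideal.rcos_ring_hom[OF cyc_ideal_ideal, of m]
  by (simp add: red_def[abs_def])

lemma red_add: "red m p \<oplus>\<^bsub>cyc_ring m\<^esub> red m q = red m (p + q)"
  using ring_hom_add[OF red_ring_hom, of p q m] by simp

lemma red_mult: "red m p \<otimes>\<^bsub>cyc_ring m\<^esub> red m q = red m (p * q)"
  using ring_hom_mult[OF red_ring_hom, of p q m] by simp

lemma red_zero: "\<zero>\<^bsub>cyc_ring m\<^esub> = red m 0"
  using ring_hom_zero[OF red_ring_hom cring.axioms(1)[OF class_cring.is_cring]
      cring.axioms(1)[OF cyc_ring_cring], of m, symmetric] by simp

text \<open>The explicit set is a submodule containing both generators, hence contains the span;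
  conversely the span is closed under the operations that build its elements.\<close>

lemma generated_pair:
  fixes p q r s :: "'a::field poly"
  shows "generated m {(red m p, red m q), (red m r, red m s)} =
    {(red m (a * p + b * r), red m (a * q + b * s)) | a b. True}" (is "_ = ?N")
proof -
  interpret Module.module "cyc_ring m" "cyc_square m :: (_, 'a poly set \<times> 'a poly set) Module.module"
    by (rule cyc_square_module)
  let ?S = "{(red m p, red m q), (red m r, red m s)}"
  have add: "(red m a, red m b) \<oplus>\<^bsub>cyc_square m\<^esub> (red m c, red m d) = (red m (a + c), red m (b + d))"
    for a b c d :: "'a poly"
    by (simp add: cyc_square_def red_add)
  have smult: "red m c \<odot>\<^bsub>cyc_square m\<^esub> (red m a, red m b) = (red m (c * a), red m (c * b))"
    for a b c :: "'a poly"
    by (simp add: cyc_square_def red_mult)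
  have carrier: "(red m a, red m b) \<in> carrier (cyc_square m)" for a b :: "'a poly"
    by (simp add: cyc_square_def carrier_cyc_ring)
  have zero: "\<zero>\<^bsub>cyc_square m\<^esub> = (red m 0, red m 0 :: 'a poly set)"
    by (simp add: cyc_square_def red_zero)
  have S: "?S \<subseteq> carrier (cyc_square m)" using carrier by simp
  have mem_N: "x \<in> ?N \<longleftrightarrow> (\<exists>a b. x = (red m (a * p + b * r), red m (a * q + b * s)))" for x
    by auto
  have N: "LinearCombinations.submodule (cyc_ring m) ?N (cyc_square m)"
  proof
    show "?N \<subseteq> carrier (cyc_square m)" using carrier by auto
    show "\<zero>\<^bsub>cyc_square m\<^esub> \<in> ?N"
      unfolding mem_N zero by (intro exI[of _ 0]) simp
  next
    fix x y assume "x \<in> ?N" "y \<in> ?N"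
    then obtain a b c d where
      "x = (red m (a * p + b * r), red m (a * q + b * s))"
      "y = (red m (c * p + d * r), red m (c * q + d * s))"
      unfolding mem_N by blast
    then have "x \<oplus>\<^bsub>cyc_square m\<^esub> y =
        (red m ((a + c) * p + (b + d) * r), red m ((a + c) * q + (b + d) * s))"
      by (simp add: add algebra_simps)
    then show "x \<oplus>\<^bsub>cyc_square m\<^esub> y \<in> ?N" unfolding mem_N by blast
  next
    fix h :: "'a poly set" and x assume "h \<in> carrier (cyc_ring m)" "x \<in> ?N"
    then obtain a b c where "h = red m c"
      "x = (red m (a * p + b * r), red m (a * q + b * s))"
      unfolding mem_N carrier_cyc_ring by blast
    then have "h \<odot>\<^bsub>cyc_square m\<^esub> x =
        (red m ((c * a) * p + (c * b) * r), red m ((c * a) * q + (c * b) * s))"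
      by (simp add: smult algebra_simps)
    then show "h \<odot>\<^bsub>cyc_square m\<^esub> x \<in> ?N" unfolding mem_N by blast
  qed
  show ?thesis unfolding generated_def
  proof
    have "(red m p, red m q) = (red m (1 * p + 0 * r), red m (1 * q + 0 * s))"
      "(red m r, red m s) = (red m (0 * p + 1 * r), red m (0 * q + 1 * s))" by simp_all
    then have "?S \<subseteq> ?N" by blast
    then show "span ?S \<subseteq> ?N" by (rule span_is_subset[OF _ N])
  next
    have span: "LinearCombinations.submodule (cyc_ring m) (span ?S) (cyc_square m)"
      using S by (rule span_is_submodule)
    have gens: "(red m p, red m q) \<in> span ?S" "(red m r, red m s) \<in> span ?S"
      using in_own_span[OF S] by simp_all
    have "(red m (a * p + b * r), red m (a * q + b * s)) \<in> span ?S" for a b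
    proof -
      have "red m a \<odot>\<^bsub>cyc_square m\<^esub> (red m p, red m q) \<oplus>\<^bsub>cyc_square m\<^esub>
          red m b \<odot>\<^bsub>cyc_square m\<^esub> (red m r, red m s) \<in> span ?S"
        by (intro submodule.m_closed[OF span] submodule.smult_closed[OF span] gens)
          (simp_all add: carrier_cyc_ring)
      then show ?thesis by (simp add: smult add)
    qed
    then show "?N \<subseteq> span ?S" by blast
  qed
qed

text \<open>The first component of a codeword fixes the multiplier \<open>a\<close> of the first
  generator only modulo \<open>h = X / g11\<close>. The last hypothesis says
  \<open>g22 dvd h * g12\<close>, so this ambiguity does not change the second component modulo
  \<open>g22\<close>, and the exact quotient \<open>s = u / g11\<close> can replace
  \<open>a\<close>.\<close>

lemma mem_generated_triangular_iff:
  fixes g11 g12 g22 u v :: "'a::field poly"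
  assumes "m \<ge> 1" "g11 dvd monom 1 m - 1" "g22 dvd monom 1 m - 1"
    and "g11 * g22 dvd (monom 1 m - 1) * g12"
  shows "(red m u, red m v) \<in> generated m {(red m g11, red m g12), (red m 0, red m g22)} \<longleftrightarrow>
    (\<exists>s. u = g11 * s \<and> g22 dvd v - s * g12)"
proof
  let ?X = "monom 1 m - 1 :: 'a poly"
  assume "(red m u, red m v) \<in> generated m {(red m g11, red m g12), (red m 0, red m g22)}"
  then obtain a b where "red m u = red m (a * g11)" "red m v = red m (a * g12 + b * g22)"
    by (auto simp: generated_pair)
  then have u: "?X dvd u - a * g11" and v: "?X dvd v - (a * g12 + b * g22)"
    by (simp_all add: red_eq_iff)
  have "g11 \<noteq> 0" using assms(1,2) coeff_0_xm1[OF assms(1), where 'a='a] by force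
  obtain h where h: "?X = g11 * h" using assms(2) by (elim dvdE)
  have "g11 dvd u - a * g11" using u assms(2) by (rule dvd_trans[rotated])
  then have "g11 dvd u" by (simp add: dvd_diff_left_iff)
  then obtain s where s: "u = g11 * s" by (elim dvdE)
  have "g11 * h dvd g11 * (s - a)" using u by (simp add: h s algebra_simps)
  then have "h dvd s - a" using \<open>g11 \<noteq> 0\<close> by simp
  moreover have "g22 dvd h * g12" using assms(4) \<open>g11 \<noteq> 0\<close> by (simp add: h mult.assoc)
  ultimately have 1: "g22 dvd (s - a) * g12" by (meson dvd_refl dvd_trans mult_dvd_mono)
  have 2: "g22 dvd v - (a * g12 + b * g22)" using v assms(3) by (rule dvd_trans[rotated])
  have "v - s * g12 = (v - (a * g12 + b * g22)) - (s - a) * g12 + b * g22"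
    by (simp add: algebra_simps)
  moreover have "g22 dvd (v - (a * g12 + b * g22)) - (s - a) * g12 + b * g22"
    by (rule dvd_add[OF dvd_diff[OF 2 1] dvd_triv_right])
  ultimately show "\<exists>s. u = g11 * s \<and> g22 dvd v - s * g12" using s by metis
next
  assume "\<exists>s. u = g11 * s \<and> g22 dvd v - s * g12"
  then obtain s where "u = g11 * s" "g22 dvd v - s * g12" by blast
  moreover from this(2) obtain b where "v - s * g12 = g22 * b" by (elim dvdE)
  ultimately have "u = s * g11 + b * 0" "v = s * g12 + b * g22" by (simp_all add: algebra_simps)
  then show "(red m u, red m v) \<in> generated m {(red m g11, red m g12), (red m 0, red m g22)}"
    unfolding generated_pair by blast
qed

text \<open>Pairing with the codeword with coefficients \<open>a\<close>, \<open>b\<close> gives a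
  \<tau>-term in \<open>a\<close> plus one in \<open>b\<close>. Setting either to 0 separates the
  terms, and nondegeneracy of \<tau> turns each into a divisibility.\<close>

lemma symplectic_dual_generated_triangular_iff:
  fixes g11 g12 g22 u v :: "'a::field poly"
  assumes "m \<ge> 1"
  shows "(red m u, red m v) \<in>
      symplectic_dual m (generated m {(red m g11, red m g12), (red m 0, red m g22)}) \<longleftrightarrow>
    monom 1 m - 1 dvd u * conj_poly m g22 \<and>
    monom 1 m - 1 dvd u * conj_poly m g12 - v * conj_poly m g11"
proof -
  let ?X = "monom 1 m - 1 :: 'a poly"
  let ?t = "\<lambda>w. coeff (w mod ?X) 0"
  let ?w1 = "u * conj_poly m g12 - v * conj_poly m g11" and ?w2 = "u * conj_poly m g22"
  have form: "symplectic_form m (red m u, red m v) (red m (a * g11 + b * 0), red m (a * g12 + b * g22))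
      = ?t (?w1 * conj_poly m a) + ?t (?w2 * conj_poly m b)" for a b
    unfolding symplectic_form_def
    by (simp add: euclidean_form_red_eq_coeff[OF assms] conj_poly_simps algebra_simps
        poly_mod_diff_left poly_mod_add_left)
  have ball: "(\<forall>x\<in>{h a b | a b. True}. P x) \<longleftrightarrow> (\<forall>a b. P (h a b))"
    for h :: "'a poly \<Rightarrow> 'a poly \<Rightarrow> 'a poly set \<times> 'a poly set" and P
    by blast
  have carrier: "(red m u, red m v) \<in> carrier (cyc_square m)"
    by (simp add: cyc_square_def carrier_cyc_ring)
  have "(red m u, red m v) \<in>
      symplectic_dual m (generated m {(red m g11, red m g12), (red m 0, red m g22)}) \<longleftrightarrow>
    (\<forall>a b. ?t (?w1 * conj_poly m a) + ?t (?w2 * conj_poly m b) = 0)"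
    unfolding symplectic_dual_def generated_pair ball by (simp only: mem_Collect_eq carrier simp_thms form)
  also have "\<dots> \<longleftrightarrow> (\<forall>a. ?t (?w1 * conj_poly m a) = 0) \<and> (\<forall>b. ?t (?w2 * conj_poly m b) = 0)"
    (is "?L \<longleftrightarrow> ?R")
  proof
    assume L: ?L
    show ?R
    proof (intro conjI allI)
      show "?t (?w1 * conj_poly m a) = 0" for a
        using L[rule_format, of a 0] by (simp add: conj_poly_simps)
      show "?t (?w2 * conj_poly m b) = 0" for b
        using L[rule_format, of 0 b] by (simp add: conj_poly_simps)
    qed
  qed simp
  finally show ?thesis unfolding dvd_iff_trace_zero[OF assms, symmetric] by blast
qed

text \<open>The two factors are congruent modulo \<open>X\<close>. The spare summand
  \<open>q\<close> lets the exchange be made in one term of a difference at a time.\<close>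

lemma dvd_mult_conj_poly_iff:
  fixes p f :: "'a::field poly"
  assumes "m \<ge> 1" "degree f \<le> m"
  shows "monom 1 m - 1 dvd q + p * conj_poly m f \<longleftrightarrow>
    monom 1 m - 1 dvd q + monom 1 (m - degree f) * p * reflect_poly f"
proof -
  have "monom 1 m - 1 dvd p * (transpose_poly m f - conj_poly m f)"
    using transpose_poly_cong_conj_poly[OF assms] by (rule dvd_mult)
  then have "monom 1 m - 1 dvd q + p * conj_poly m f \<longleftrightarrow>
      monom 1 m - 1 dvd p * (transpose_poly m f - conj_poly m f) + (q + p * conj_poly m f)"
    by (rule dvd_add_right_iff[symmetric])
  also have "p * (transpose_poly m f - conj_poly m f) + (q + p * conj_poly m f) =
      q + monom 1 (m - degree f) * p * reflect_poly f"
    by (simp add: transpose_poly_eq_reflect_poly[OF assms(2)] algebra_simps)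
  finally show ?thesis .
qed

section \<open>The criterion for dual containment\<close>

text \<open>Of the factor \<open>x^m\<close>, the part \<open>x^(m - degree b)\<close> cancels
  against the transpose, and the rest is coprime to \<open>a * reflect_poly b\<close>, whose
  constant term is nonzero.\<close>

lemma first_condition_iff:
  fixes a b :: "'a::field poly"
  assumes "m \<ge> 1" "a dvd monom 1 m - 1" "b dvd monom 1 m - 1"
  shows "a * transpose_poly m b dvd monom 1 m * (monom 1 m - 1) \<longleftrightarrow>
    a * reflect_poly b dvd monom 1 m - 1"
proof -
  let ?X = "monom 1 m - 1 :: 'a poly"
  have X0: "coeff ?X 0 \<noteq> 0" using coeff_0_xm1[OF assms(1), where 'a='a] by simp
  then have "?X \<noteq> 0" by force
  then have deg: "degree b \<le> m"
    using dvd_imp_degree_le[OF assms(3)] degree_xm1[OF assms(1), where 'a='a] by simp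
  have c: "coeff (a * reflect_poly b) 0 \<noteq> 0"
    using coeff_0_nonzero_of_dvd[OF assms(2) X0] coeff_0_nonzero_of_dvd[OF assms(3) X0]
    by (auto simp: coeff_mult)
  have "monom 1 m * ?X = monom 1 (m - degree b) * (monom 1 (degree b) * ?X)"
    using deg by (simp add: mult_monom flip: mult.assoc)
  then have "a * transpose_poly m b dvd monom 1 m * ?X \<longleftrightarrow>
      monom 1 (m - degree b) * (a * reflect_poly b) dvd
      monom 1 (m - degree b) * (monom 1 (degree b) * ?X)"
    by (simp only: transpose_poly_eq_reflect_poly[OF deg] mult.left_commute)
  also have "\<dots> \<longleftrightarrow> a * reflect_poly b dvd monom 1 (degree b) * ?X"
    by (simp add: monom_eq_0_iff)
  finally show ?thesis using c by (simp add: monom_mult_dvd_cancel)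
qed

text \<open>Since \<open>b\<close> and \<open>x^k\<close> are coprime, once \<open>x^k\<close> is
  known to divide the right-hand side only divisibility by \<open>b\<close> remains.\<close>

lemma mult_monom_dvd_monom_mult_iff:
  fixes b z :: "'a::idom poly"
  assumes "coeff b 0 \<noteq> 0" "monom 1 k dvd monom 1 n * z"
  shows "b * monom 1 k dvd monom 1 n * z \<longleftrightarrow> b dvd z"
proof -
  obtain y where y: "monom 1 n * z = monom 1 k * y" using assms(2) by (elim dvdE)
  have "b * monom 1 k dvd monom 1 n * z \<longleftrightarrow> monom 1 k * b dvd monom 1 k * y"
    unfolding y by (simp only: mult.commute)
  also have "\<dots> \<longleftrightarrow> b dvd y" by (simp add: monom_eq_0_iff)
  also have "\<dots> \<longleftrightarrow> b dvd monom 1 n * z" by (simp only: y monom_mult_dvd_cancel[OF assms(1)])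
  finally show ?thesis by (simp add: monom_mult_dvd_cancel[OF assms(1)])
qed

text \<open>Both sides of the divisibility share the factor \<open>a * ?a * ?b\<close>. Cancelling
  it leaves \<open>b\<close> times a power of \<open>x\<close> on the left and
  \<open>x^m * ?z\<close> on the right; the power of \<open>x\<close> divides the latter by degree
  bounds.\<close>

lemma second_condition_iff:
  fixes a b g q k :: "'a::field poly"
  assumes "m \<ge> 1" "a dvd monom 1 m - 1" "b dvd monom 1 m - 1" "g = 0 \<or> degree g < degree b"
    and q: "monom 1 m - 1 = reflect_poly b * (a * q)"
    and k: "reflect_poly a * k = (a * q) * reflect_poly g"
  shows "a * transpose_poly m a * b * transpose_poly m b dvd
      monom 1 m * (monom 1 m - 1) * (a * transpose_poly m g - transpose_poly m a * g) \<longleftrightarrow>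
    b dvd monom 1 (m - degree g) * k - monom 1 (m - degree a) * q * g"
proof -
  let ?X = "monom 1 m - 1 :: 'a poly"
  let ?a = "reflect_poly a" and ?b = "reflect_poly b" and ?g = "reflect_poly g"
  let ?e = "m - degree g" and ?f = "m - degree a" and ?h = "m - degree b"
  let ?z = "monom 1 ?e * k - monom 1 ?f * q * g"
  have X0: "coeff ?X 0 \<noteq> 0" using coeff_0_xm1[OF assms(1), where 'a='a] by simp
  then have "?X \<noteq> 0" by force
  then have deg: "degree a \<le> m" "degree b \<le> m"
    using dvd_imp_degree_le[OF assms(2)] dvd_imp_degree_le[OF assms(3)]
      degree_xm1[OF assms(1), where 'a='a] by simp_all
  then have deg': "degree g \<le> m" using assms(4) by auto
  have b0: "coeff b 0 \<noteq> 0" using assms(3) X0 by (rule coeff_0_nonzero_of_dvd)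
  have nz: "a * ?a * ?b \<noteq> 0" using \<open>?X \<noteq> 0\<close> assms(2) by (auto simp: q)
  have "a * transpose_poly m a * b * transpose_poly m b =
      (a * ?a * ?b) * (b * monom 1 (?f + ?h))"
  proof -
    have "monom 1 (?f + ?h) = monom 1 ?f * (monom 1 ?h :: 'a poly)" by (simp add: mult_monom)
    then show ?thesis by (simp only: transpose_poly_eq_reflect_poly deg ac_simps)
  qed
  moreover have "monom 1 m * ?X * (a * transpose_poly m g - transpose_poly m a * g) =
      (a * ?a * ?b) * (monom 1 m * ?z)"
  proof -
    have "monom 1 m * ?X * (a * transpose_poly m g - transpose_poly m a * g) =
        (a * ?b * monom 1 m) * (monom 1 ?e * ((a * q) * ?g) - monom 1 ?f * ?a * q * g)"
      by (simp add: q transpose_poly_eq_reflect_poly deg deg' algebra_simps)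
    also have "\<dots> = (a * ?a * ?b) * (monom 1 m * ?z)"
      \<comment> \<open>The relation \<open>k\<close> extracts the factor \<open>?a\<close> from the
        first term; the second already contains it.\<close>
      by (simp only: k[symmetric]) (simp add: algebra_simps)
    finally show ?thesis .
  qed
  ultimately have "a * transpose_poly m a * b * transpose_poly m b dvd
      monom 1 m * ?X * (a * transpose_poly m g - transpose_poly m a * g) \<longleftrightarrow>
    b * monom 1 (?f + ?h) dvd monom 1 m * ?z"
    using nz by (simp only: dvd_mult_cancel_left simp_thms)
  moreover have "monom 1 (?f + ?h) dvd monom 1 m * ?z"
  proof -
    have *: "monom 1 i dvd (monom 1 j :: 'a poly)" if "i \<le> j" for i j
      using that by (metis dvd_triv_left le_Suc_ex mult_1 mult_monom)
    have "monom 1 (?f + ?h) dvd monom 1 m * (monom 1 ?e * k)"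
    proof (cases "k = 0")
      case False
      with k nz have "g \<noteq> 0" by auto
      \<comment> \<open>This amounts to \<open>degree g \<le> degree a + degree b\<close>, which
        follows from \<open>degree g < degree b\<close>.\<close>
      then have "?f + ?h \<le> m + ?e" using assms(4) deg by auto
      then have "monom 1 (?f + ?h) dvd monom 1 (m + ?e) * k" by (intro dvd_mult2 *)
      then show ?thesis by (simp add: mult_monom flip: mult.assoc)
    qed simp
    moreover have "monom 1 (?f + ?h) dvd monom 1 m * (monom 1 ?f * q * g)"
    proof -
      have "monom 1 (?f + ?h) dvd monom 1 (m + ?f) * (q * g)" by (intro dvd_mult2 *) simp
      then show ?thesis by (simp add: mult_monom flip: mult.assoc)
    qed
    ultimately show ?thesis by (simp add: right_diff_distrib dvd_diff)
  qed
  ultimately show ?thesis using mult_monom_dvd_monom_mult_iff[OF b0] by blast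
qed

theorem theorem5p5:
  fixes m :: nat
    and D :: "'a::{field,finite} vec set"
    and C :: "('a poly set \<times> 'a poly set) set"
    and g11 g12 g22 :: "'a poly"
  assumes "m \<ge> 1"
    and "quasi_cyclic_code (2 * m) 2 D"
    and "C = vec_to_pair m ` D"
    and "C = generated m {(red m g11, red m g12), (red m 0, red m g22)}"
    and "g11 dvd monom 1 m - 1"
    and "g22 dvd monom 1 m - 1"
    and "g12 = 0 \<or> degree g12 < degree g22"
    and "g11 * g22 dvd (monom 1 m - 1) * g12"
  shows "symplectic_dual m C \<subseteq> C \<longleftrightarrow>
    g11 * transpose_poly m g22 dvd monom 1 m * (monom 1 m - 1) \<and>
    g11 * transpose_poly m g11 * g22 * transpose_poly m g22 dvd
      monom 1 m * (monom 1 m - 1) *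
        (g11 * transpose_poly m g12 - transpose_poly m g11 * g12)"
proof -
  let ?X = "monom 1 m - 1 :: 'a poly"
  let ?a = "reflect_poly g11" and ?b = "reflect_poly g22" and ?g = "reflect_poly g12"
  let ?e = "m - degree g12" and ?f = "m - degree g11"
  note m = assms(1)
  have X0: "coeff ?X 0 \<noteq> 0" using coeff_0_xm1[OF m, where 'a='a] by simp
  then have "?X \<noteq> 0" by force
  then have deg: "degree g11 \<le> m" "degree g22 \<le> m"
    using dvd_imp_degree_le[OF assms(5)] dvd_imp_degree_le[OF assms(6)]
      degree_xm1[OF m, where 'a='a] by simp_all
  then have deg': "degree g12 \<le> m" using assms(7) by auto
  have b0: "coeff g22 0 \<noteq> 0" using assms(6) X0 by (rule coeff_0_nonzero_of_dvd)
  obtain p where p: "?X = ?a * p" using reflect_poly_dvd_xm1[OF m assms(5)] by (elim dvdE)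
  obtain q where q: "?X = ?b * q" using reflect_poly_dvd_xm1[OF m assms(6)] by (elim dvdE)
  have nz: "?a \<noteq> 0" "?b \<noteq> 0" "p \<noteq> 0" "q \<noteq> 0" using \<open>?X \<noteq> 0\<close> p q by force+
  \<comment> \<open>Reflecting the last hypothesis and cancelling \<open>?b\<close> yields the
    cofactor \<open>k\<close>.\<close>
  have "?a * ?b dvd ?X * ?g"
    using reflect_poly_dvd_reflect_poly[OF assms(8)]
    by (simp only: reflect_poly_mult reflect_poly_xm1[OF m] mult_minus_left dvd_minus_iff)
  then have "?b * ?a dvd ?b * (q * ?g)" by (simp add: q ac_simps)
  then have "?a dvd q * ?g" using nz by simp
  then obtain k where k: "?a * k = q * ?g" by (metis dvdE)
  have mem_C: "(red m u, red m v) \<in> C \<longleftrightarrow> (\<exists>s. u = g11 * s \<and> g22 dvd v - s * g12)" for u v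
    unfolding assms(4) by (rule mem_generated_triangular_iff) (use assms in auto)
  \<comment> \<open>The power of \<open>x\<close> drops out of the first condition, but the two
    terms of the second carry different powers, which must be kept.\<close>
  have mem_dual: "(red m u, red m v) \<in> symplectic_dual m C \<longleftrightarrow>
      q dvd u \<and> ?X dvd monom 1 ?e * u * ?g - monom 1 ?f * v * ?a" for u v
  proof -
    have "?X dvd u * conj_poly m g22 \<longleftrightarrow> ?X dvd monom 1 (m - degree g22) * u * ?b"
      using dvd_mult_conj_poly_iff[OF m deg(2), of 0 u] by simp
    also have "\<dots> \<longleftrightarrow> ?X dvd ?b * u"
      using monom_mult_dvd_cancel[OF X0] by (simp add: mult.assoc mult.commute[of ?b])
    also have "\<dots> \<longleftrightarrow> q dvd u" using nz by (simp add: q)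
    finally have 1: "?X dvd u * conj_poly m g22 \<longleftrightarrow> q dvd u" .
    have "?X dvd u * conj_poly m g12 - v * conj_poly m g11 \<longleftrightarrow>
        ?X dvd u * conj_poly m g12 + (- v) * conj_poly m g11" by simp
    also have "\<dots> \<longleftrightarrow> ?X dvd - (monom 1 ?f * v * ?a) + u * conj_poly m g12"
      by (subst dvd_mult_conj_poly_iff[OF m deg(1)]) (simp add: algebra_simps)
    also have "\<dots> \<longleftrightarrow> ?X dvd monom 1 ?e * u * ?g - monom 1 ?f * v * ?a"
      by (subst dvd_mult_conj_poly_iff[OF m deg']) (simp add: algebra_simps)
    finally show ?thesis
      unfolding assms(4) symplectic_dual_generated_triangular_iff[OF m] 1 by blast
  qed
  have cond1: "g11 * transpose_poly m g22 dvd monom 1 m * ?X \<longleftrightarrow> g11 * ?b dvd ?X"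
    by (rule first_condition_iff[OF m assms(5,6)])
  \<comment> \<open>Condition 1 is needed in two forms: \<open>g22 dvd p\<close> puts
    \<open>(0, p)\<close> in the code, and \<open>g11 dvd q\<close> lets \<open>q\<close> be the
    first component of a codeword.\<close>
  have cond1': "g11 * ?b dvd ?X \<longleftrightarrow> g22 dvd p"
  proof -
    have "g11 * ?b dvd ?X \<longleftrightarrow> ?a * g22 dvd ?a * p"
      using reflect_poly_mult_dvd_xm1_commute[OF m assms(5,6)] by (simp add: p mult.commute)
    then show ?thesis using nz by simp
  qed
  have cond1'': "g11 * ?b dvd ?X \<longleftrightarrow> g11 dvd q"
    using nz by (simp add: q mult.commute[of g11])
  show ?thesis (is "_ \<longleftrightarrow> ?c1 \<and> ?c2")
  proof
    assume sub: "symplectic_dual m C \<subseteq> C"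
    have "(red m 0, red m p) \<in> symplectic_dual m C"
      unfolding mem_dual by (simp add: p mult.assoc mult.left_commute[of ?a] mult.commute[of p])
    with sub have "(red m 0, red m p) \<in> C" by blast
    \<comment> \<open>With first component 0 the multiplier \<open>s\<close> in \<open>mem_C\<close>
      must be 0, as \<open>g11\<close> is nonzero.\<close>
    then have c1: "g22 dvd p" using \<open>?X \<noteq> 0\<close> assms(5) by (auto simp: mem_C)
    then obtain q' where q': "q = g11 * q'" using cond1' cond1'' by (blast elim: dvdE)
    \<comment> \<open>The crossed powers of \<open>x\<close> make both terms of the second dual
      condition carry \<open>x^(?e + ?f)\<close>, so they cancel by \<open>k\<close>.\<close>
    have "(red m (monom 1 ?f * q), red m (monom 1 ?e * k)) \<in> symplectic_dual m C"
    proof -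
      have "monom 1 ?e * (monom 1 ?f * q) * ?g - monom 1 ?f * (monom 1 ?e * k) * ?a =
          monom 1 ?e * monom 1 ?f * (q * ?g - ?a * k)" by (simp add: algebra_simps)
      then show ?thesis by (simp only: mem_dual k) simp
    qed
    with sub have "(red m (monom 1 ?f * q), red m (monom 1 ?e * k)) \<in> C" by blast
    then obtain s where s: "monom 1 ?f * q = g11 * s" "g22 dvd monom 1 ?e * k - s * g12"
      unfolding mem_C by blast
    have "g11 * s = g11 * (monom 1 ?f * q')" by (simp only: q' mult.left_commute flip: s(1))
    then have "s = monom 1 ?f * q'" using nz by auto
    then have "g22 dvd monom 1 ?e * k - monom 1 ?f * q' * g12" using s(2) by simp
    then have ?c2 using second_condition_iff[OF m assms(5-7), of q' k] q k q' by simp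
    then show "?c1 \<and> ?c2" using c1 cond1 cond1' by simp
  next
    assume "?c1 \<and> ?c2"
    then have c1: "g22 dvd p" "g11 dvd q" and ?c2
      using cond1 cond1' cond1'' by auto
    obtain q' where q': "q = g11 * q'" using c1(2) by (elim dvdE)
    have c2: "g22 dvd monom 1 ?e * k - monom 1 ?f * q' * g12"
      using \<open>?c2\<close> second_condition_iff[OF m assms(5-7), of q' k] q k q' by simp
    show "symplectic_dual m C \<subseteq> C"
    proof
      fix x assume x: "x \<in> symplectic_dual m C"
      then obtain u v where uv: "x = (red m u, red m v)"
        by (auto simp: symplectic_dual_def cyc_square_def carrier_cyc_ring)
      \<comment> \<open>With \<open>u = q * t\<close> the relation \<open>k\<close> exposes a factor
        \<open>?a\<close> in the second dual condition; cancelling it from \<open>X = ?a * p\<close>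
        leaves divisibility by \<open>p\<close>, hence by \<open>g22\<close>.\<close>
      from x[unfolded uv mem_dual] obtain t where t: "u = q * t"
        and "?X dvd monom 1 ?e * u * ?g - monom 1 ?f * v * ?a" by (auto elim: dvdE)
      moreover have "monom 1 ?e * u * ?g - monom 1 ?f * v * ?a =
          ?a * (monom 1 ?e * k * t - monom 1 ?f * v)"
      proof -
        have "monom 1 ?e * u * ?g = monom 1 ?e * t * (q * ?g)" by (simp add: t ac_simps)
        then show ?thesis by (simp add: k[symmetric] algebra_simps)
      qed
      ultimately have "p dvd monom 1 ?e * k * t - monom 1 ?f * v" using nz by (simp add: p)
      with c1 have "g22 dvd monom 1 ?e * k * t - monom 1 ?f * v" by (metis dvd_trans)
      \<comment> \<open>Eliminating \<open>k\<close> between the two divisibilities leaves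
        \<open>x^?f\<close> times the required difference, and \<open>x^?f\<close> cancels because
        \<open>g22\<close> has nonzero constant term.\<close>
      with c2 have "g22 dvd (monom 1 ?e * k - monom 1 ?f * q' * g12) * t -
          (monom 1 ?e * k * t - monom 1 ?f * v)" by (rule dvd_diff[OF dvd_mult2])
      also have "\<dots> = monom 1 ?f * (v - q' * t * g12)" by (simp add: algebra_simps)
      finally have "g22 dvd v - q' * t * g12" using monom_mult_dvd_cancel[OF b0] by blast
      then show "x \<in> C" unfolding uv mem_C by (intro exI[of _ "q' * t"]) (simp add: t q' mult.assoc)
    qed
  qed
qed

end
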